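(* For every integer $n\ge0$ and every nonnegative integer $r$, \[ \mathrm{Bel}_{n,\lambda}^{(r,Y)}(x)=e^{-x}\sum_{k=0}^{\infty}x^{k}\frac{E\big[(S_{k+r})_{n,\lambda}\big]}{k!}. \]
   Context: Let $\lambda$ be a nonzero real number. Define $(x)_{0,\lambda}=1$ and $(x)_{n,\lambda}=x(x-\lambda)\cdots(x-(n-1)\lambda)$ for $n\ge1$, and the degenerate exponential $e_{\lambda}^{x}(t)=(1+\lambda t)^{x/\lambda}=\sum_{n\ge0}(x)_{n,\lambda}\frac{t^n}{n!}$. Let $Y$ be a random variable whose moment generating function exists in a neighborhood of the origin, let $(Y_j)_{j\ge1}$ be mutually independent copies of $Y$, and set $S_0=0$, $S_k=Y_1+\cdots+Y_k$ for $k\ge1$. For $r$ a nonnegative integer, the probabilistic degenerate $r$-Bell polynomials associated with $Y$ are defined by \[ E\big[e_{\lambda}^{S_r}(t)\big]e^{x(E[e_{\lambda}^{Y}(t)]-1)}=\sum_{n=0}^{\infty}\mathrm{Bel}_{n,\lambda}^{(r,Y)}(x)\frac{t^n}{n!}. \] *)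

theory Defs
  imports "HOL-Probability.Probability"
begin

definition deg_falling :: "real \<Rightarrow> real \<Rightarrow> nat \<Rightarrow> real" where
  "deg_falling lam x n = (\<Prod>i<n. x - real i * lam)"

text \<open>Only meant for \<open>lam \<noteq> 0\<close> and \<open>1 + lam * t > 0\<close>, which holds for all \<open>t\<close> near \<open>0\<close>.\<close>
definition deg_exp :: "real \<Rightarrow> real \<Rightarrow> real \<Rightarrow> real" where
  "deg_exp lam x t = (1 + lam * t) powr (x / lam)"

definition mgf_exists_near_0 :: "'a measure \<Rightarrow> ('a \<Rightarrow> real) \<Rightarrow> bool" where
  "mgf_exists_near_0 M Y \<longleftrightarrow>
     (\<exists>\<delta>>0. \<forall>s. \<bar>s\<bar> < \<delta> \<longrightarrow> integrable M (\<lambda>\<omega>. exp (s * Y \<omega>)))"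

text \<open>The copies are \<open>Ys 1, Ys 2, \<dots>\<close>; the value \<open>Ys 0\<close> is irrelevant.\<close>
definition iid_copies :: "'a measure \<Rightarrow> ('a \<Rightarrow> real) \<Rightarrow> (nat \<Rightarrow> 'a \<Rightarrow> real) \<Rightarrow> bool" where
  "iid_copies M Y Ys \<longleftrightarrow>
     prob_space.indep_vars M (\<lambda>_. borel) Ys {1..} \<and>
     (\<forall>j\<ge>1. distr M borel (Ys j) = distr M borel Y)"

definition partial_sum :: "(nat \<Rightarrow> 'a \<Rightarrow> real) \<Rightarrow> nat \<Rightarrow> 'a \<Rightarrow> real" where
  "partial_sum Ys k \<omega> = (\<Sum>j=1..k. Ys j \<omega>)"

definition is_egf_of :: "(real \<Rightarrow> real) \<Rightarrow> (nat \<Rightarrow> real) \<Rightarrow> bool" where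
  "is_egf_of G b \<longleftrightarrow> (\<forall>\<^sub>F t in nhds 0. (\<lambda>n. b n * (t ^ n / fact n)) sums G t)"

lemma powser_zero_near_0:
  fixes a :: "nat \<Rightarrow> real"
  assumes "0 < s" and "\<And>t. t \<noteq> 0 \<Longrightarrow> \<bar>t\<bar> < s \<Longrightarrow> (\<lambda>k. a k * t ^ k) sums 0"
  shows "a n = 0"
proof -
  have tail: "a m = 0" if "\<And>t. t \<noteq> 0 \<Longrightarrow> \<bar>t\<bar> < s \<Longrightarrow> (\<lambda>k. a (k + m) * t ^ k) sums 0" for m
  proof -
    have "((\<lambda>t::real. 0::real) \<longlongrightarrow> a (0 + m)) (at 0)"
      by (rule powser_limit_0_strong[OF assms(1)]) (use that in \<open>simp only: real_norm_def\<close>)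
    thus "a m = 0"
      by (simp add: tendsto_const_iff)
  qed
  have "(\<lambda>k. a (k + n) * t ^ k) sums 0" if "t \<noteq> 0" "\<bar>t\<bar> < s" for t
    using that
  proof (induction n arbitrary: t)
    case 0
    thus ?case using assms(2) by simp
  next
    case (Suc n)
    have "a n = 0"
      by (rule tail) (rule Suc.IH)
    have "(\<lambda>k. a (k + n) * t ^ k) sums 0"
      by (rule Suc.IH[OF Suc.prems])
    hence "(\<lambda>k. a (Suc k + n) * t ^ Suc k) sums (0 - a (0 + n) * t ^ 0)"
      by (subst sums_Suc_iff) simp
    hence "(\<lambda>k. t * (a (k + Suc n) * t ^ k)) sums (t * 0)"
      using \<open>a n = 0\<close> by (simp add: mult_ac)
    thus ?case
      by (subst (asm) sums_mult_iff) (rule Suc.prems(1))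
  qed
  thus ?thesis
    by (rule tail)
qed

lemma is_egf_of_unique:
  assumes "is_egf_of G b" "is_egf_of G c"
  shows "b = c"
proof
  fix n
  have "\<forall>\<^sub>F t in nhds 0. (\<lambda>k. (b k / fact k - c k / fact k) * t ^ k) sums 0"
    using assms[unfolded is_egf_of_def]
  proof eventually_elim
    case (elim t)
    thus ?case using sums_diff[of _ "G t" _ "G t"] by (simp add: left_diff_distrib)
  qed
  then obtain s where "0 < s"
    and "\<forall>t. dist t 0 < s \<longrightarrow> (\<lambda>k. (b k / fact k - c k / fact k) * t ^ k) sums 0"
    unfolding eventually_nhds_metric by blast
  hence "b n / fact n - c n / fact n = 0"
    by (intro powser_zero_near_0[where a = "\<lambda>k. b k / fact k - c k / fact k"]) (auto simp only: dist_real_def diff_zero)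
  thus "b n = c n" by simp
qed

text \<open>\<open>prob_deg_r_bell M lam Y Ys r n x\<close> is the value at \<open>x\<close> of the \<open>n\<close>-th polynomial of
  order \<open>r\<close>. For each \<open>x\<close>, the whole sequence in \<open>n\<close> is characterised by the generating function
  identity for all \<open>t\<close> near \<open>0\<close>; there is at most one such sequence, by the lemma above.
  Nothing is said here about existence.\<close>
definition prob_deg_r_bell ::
  "'a measure \<Rightarrow> real \<Rightarrow> ('a \<Rightarrow> real) \<Rightarrow> (nat \<Rightarrow> 'a \<Rightarrow> real) \<Rightarrow> nat \<Rightarrow> nat \<Rightarrow> real \<Rightarrow> real" where
  "prob_deg_r_bell M lam Y Ys r n x =
     (THE b. is_egf_of
        (\<lambda>t. (\<integral>\<omega>. deg_exp lam (partial_sum Ys r \<omega>) t \<partial>M) *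
              exp (x * ((\<integral>\<omega>. deg_exp lam (Y \<omega>) t \<partial>M) - 1))) b) n"

end

theory Submission
  imports Defs
begin

text \<open>Put \<open>\<phi>(t) = E[e\<^sub>\<lambda>\<^sup>Y(t)]\<close>. By independence \<open>E[e\<^sub>\<lambda>\<^sup>S(t)] = \<phi>(t)\<^sup>m\<close> for \<open>S = S\<^sub>m\<close>, so the
  generating function is \<open>e\<^sup>-\<^sup>x \<Sum>\<^sub>k x\<^sup>k \<phi>(t)\<^bsup>k+r\<^esup> / k!\<close>, and it remains to expand each power of \<open>\<phi>\<close> in \<open>t\<close>
  and to interchange the sums and the expectation. The interchange is justified by domination:
  replacing \<open>\<lambda>, S, t\<close> by \<open>-\<bar>\<lambda>\<bar>, \<bar>S\<bar>, \<bar>t\<bar>\<close> in the binomial series makes all of its terms nonnegative and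
  no smaller than the absolute values of the original ones. Its sum \<open>(1 - \<bar>\<lambda>t\<bar>) powr (-\<bar>S\<bar>/\<bar>\<lambda>\<bar>)\<close> is \<open>exp (c \<bar>S\<bar>)\<close>
  with \<open>c \<rightarrow> 0\<close> as \<open>t \<rightarrow> 0\<close>, whose expectation grows at most geometrically in \<open>m\<close>.\<close>

section \<open>Degenerate falling factorials, the binomial series and its majorant\<close>

lemma deg_falling_gbinomial:
  assumes "lam \<noteq> 0"
  shows "deg_falling lam x n = lam ^ n * fact n * ((x / lam) gchoose n)"
proof -
  have "(\<Prod>i<n. x - real i * lam) = (\<Prod>i<n. lam * (x / lam - real i))"
    using assms by (simp add: right_diff_distrib mult.commute)
  also have "\<dots> = lam ^ n * (\<Prod>i<n. x / lam - real i)"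
    by (simp add: prod.distrib)
  finally have "(\<Prod>i<n. x - real i * lam) = lam ^ n * (\<Prod>i<n. x / lam - real i)" .
  thus ?thesis
    by (simp add: deg_falling_def gbinomial_prod_rev atLeast0LessThan)
qed

lemma deg_exp_sums:
  assumes "lam \<noteq> 0" "\<bar>lam * t\<bar> < 1"
  shows "(\<lambda>n. deg_falling lam x n * (t ^ n / fact n)) sums deg_exp lam x t"
  using gen_binomial_real[OF assms(2), of "x / lam"] assms(1)
  by (simp add: deg_falling_gbinomial deg_exp_def power_mult_distrib mult_ac)

lemma deg_exp_eq_exp:
  assumes "1 + lam * t > 0"
  shows "deg_exp lam x t = exp (x * (ln (1 + lam * t) / lam))"
  using assms by (simp add: deg_exp_def powr_def)

lemma deg_exp_sum:
  assumes "1 + lam * t > 0"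
  shows "deg_exp lam (\<Sum>j\<in>A. f j) t = (\<Prod>j\<in>A. deg_exp lam (f j) t)"
proof (cases "finite A")
  case True
  thus ?thesis by (simp add: deg_exp_eq_exp[OF assms] sum_distrib_right exp_sum del: times_divide_eq_right)
qed (use assms in \<open>simp add: deg_exp_eq_exp\<close>)

lemma measurable_deg_falling [measurable]: "(\<lambda>x. deg_falling lam x n) \<in> borel_measurable borel"
  unfolding deg_falling_def by measurable

lemma measurable_deg_exp [measurable]: "(\<lambda>x. deg_exp lam x t) \<in> borel_measurable borel"
  unfolding deg_exp_def by measurable

text \<open>The triangle inequality is applied factor by factor: with parameter
  \<open>- \<bar>lam\<bar>\<close> the factors become
  \<open>\<bar>x\<bar> + i * \<bar>lam\<bar>\<close>, so the majorant is a rising product of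
  nonnegative numbers.\<close>

lemma abs_deg_falling_le: "\<bar>deg_falling lam x n\<bar> \<le> deg_falling (- \<bar>lam\<bar>) \<bar>x\<bar> n"
  unfolding deg_falling_def abs_prod
proof (rule prod_mono, safe)
  fix i
  show "\<bar>x - real i * lam\<bar> \<le> \<bar>x\<bar> - real i * - \<bar>lam\<bar>"
    using abs_triangle_ineq4[of x "real i * lam"] by (simp add: abs_mult)
qed simp

lemma sum_abs_deg_falling_le:
  assumes "lam \<noteq> 0" "\<bar>lam * t\<bar> < 1"
  shows "(\<Sum>n<N. \<bar>deg_falling lam x n * (t ^ n / fact n)\<bar>) \<le> deg_exp (- \<bar>lam\<bar>) \<bar>x\<bar> \<bar>t\<bar>"
proof -
  have sums: "(\<lambda>n. deg_falling (- \<bar>lam\<bar>) \<bar>x\<bar> n * (\<bar>t\<bar> ^ n / fact n)) sums deg_exp (- \<bar>lam\<bar>) \<bar>x\<bar> \<bar>t\<bar>"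
    using assms by (intro deg_exp_sums) (auto simp: abs_mult)
  have le: "\<bar>deg_falling lam x n * (t ^ n / fact n)\<bar> \<le> deg_falling (- \<bar>lam\<bar>) \<bar>x\<bar> n * (\<bar>t\<bar> ^ n / fact n)" for n
    using mult_right_mono[OF abs_deg_falling_le, of "\<bar>t\<bar> ^ n / fact n" lam x n] by (simp add: abs_mult power_abs)
  have "(\<Sum>n<N. \<bar>deg_falling lam x n * (t ^ n / fact n)\<bar>)
      \<le> (\<Sum>n<N. deg_falling (- \<bar>lam\<bar>) \<bar>x\<bar> n * (\<bar>t\<bar> ^ n / fact n))"
    by (rule sum_mono) (rule le)
  also have "\<dots> \<le> deg_exp (- \<bar>lam\<bar>) \<bar>x\<bar> \<bar>t\<bar>"
    using sum_le_suminf[OF sums_summable[OF sums], of "{..<N}"] le sums_unique[OF sums]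
    by (metis (no_types, lifting) abs_ge_zero finite_lessThan order_trans)
  finally show ?thesis .
qed

text \<open>This replaces the absolute value of a partial sum by the sum of the absolute values,
  over which the majorant factors. It holds because the majorant is an exponential with nonnegative
  rate.\<close>

lemma deg_exp_abs_mono:
  assumes "\<bar>lam * t\<bar> < 1" "\<bar>x\<bar> \<le> y"
  shows "deg_exp (- \<bar>lam\<bar>) \<bar>x\<bar> \<bar>t\<bar> \<le> deg_exp (- \<bar>lam\<bar>) y \<bar>t\<bar>"
proof -
  have "ln (1 - \<bar>lam\<bar> * \<bar>t\<bar>) \<le> 0"
    using assms(1) by (subst ln_le_zero_iff) (auto simp: abs_mult)
  \<comment> \<open>At \<open>lam = 0\<close> the quotient is 0 by the convention on division by
    zero.\<close>
  hence "ln (1 + - \<bar>lam\<bar> * \<bar>t\<bar>) / - \<bar>lam\<bar> \<ge> 0"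
    by (intro divide_nonpos_nonpos) auto
  hence "\<bar>x\<bar> * (ln (1 + - \<bar>lam\<bar> * \<bar>t\<bar>) / - \<bar>lam\<bar>) \<le> y * (ln (1 + - \<bar>lam\<bar> * \<bar>t\<bar>) / - \<bar>lam\<bar>)"
    by (rule mult_right_mono[OF assms(2)])
  moreover have "1 + - \<bar>lam\<bar> * \<bar>t\<bar> > 0"
    using assms(1) by (simp add: abs_mult)
  ultimately show ?thesis
    by (simp only: deg_exp_eq_exp exp_le_cancel_iff)
qed

section \<open>Interchanging a series with an integral or with another series\<close>

lemma
  fixes f :: "nat \<Rightarrow> 'a \<Rightarrow> real"
  assumes f: "\<And>i. f i \<in> borel_measurable M" and w: "integrable M w"
    and le: "\<And>N x. x \<in> space M \<Longrightarrow> (\<Sum>i<N. \<bar>f i x\<bar>) \<le> w x"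
  shows integrable_dominated_series: "integrable M (f i)"
    and sums_integral_dominated: "(\<lambda>i. \<integral>x. f i x \<partial>M) sums (\<integral>x. (\<Sum>i. f i x) \<partial>M)"
    and sum_abs_integral_dominated_le: "(\<Sum>i<N. \<bar>\<integral>x. f i x \<partial>M\<bar>) \<le> (\<integral>x. w x \<partial>M)"
proof -
  \<comment> \<open>Bounding the partial sums of absolute values by \<open>w\<close> controls three
    things at once: each term (integrability), the pointwise series (summability), and the signed
    partial sums (dominated convergence).\<close>
  have fw: "\<bar>f i x\<bar> \<le> w x" if "x \<in> space M" for i x
    using member_le_sum[of i "{..<Suc i}" "\<lambda>i. \<bar>f i x\<bar>"] le[OF that, of "Suc i"]
    by (simp del: sum.lessThan_Suc)
  show int: "integrable M (f i)" for i
    by (rule Bochner_Integration.integrable_bound[OF w f]) (auto intro!: AE_I2 order_trans[OF fw])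
  have summable: "summable (\<lambda>i. f i x)" if "x \<in> space M" for x
    by (rule summable_rabs_cancel, rule bounded_imp_summable[of _ "w x"])
      (use le[OF that] in \<open>auto simp del: sum.lessThan_Suc simp flip: lessThan_Suc_atMost\<close>)
  have "(\<lambda>N. \<integral>x. (\<Sum>i<N. f i x) \<partial>M) \<longlonglongrightarrow> (\<integral>x. (\<Sum>i. f i x) \<partial>M)"
  proof (rule integral_dominated_convergence[where w = w])
    show "AE x in M. (\<lambda>N. \<Sum>i<N. f i x) \<longlonglongrightarrow> (\<Sum>i. f i x)"
      by (intro AE_I2 summable_LIMSEQ summable)
    show "AE x in M. norm (\<Sum>i<N. f i x) \<le> w x" for N
      by (rule AE_I2) (auto intro: order_trans[OF sum_abs] le)
  qed (use f w in \<open>auto intro: borel_measurable_suminf\<close>)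
  thus "(\<lambda>i. \<integral>x. f i x \<partial>M) sums (\<integral>x. (\<Sum>i. f i x) \<partial>M)"
    using int by (simp add: sums_def Bochner_Integration.integral_sum)
  have "(\<Sum>i<N. \<bar>\<integral>x. f i x \<partial>M\<bar>) \<le> (\<Sum>i<N. \<integral>x. \<bar>f i x\<bar> \<partial>M)"
    by (intro sum_mono integral_abs_bound)
  also have "\<dots> = (\<integral>x. (\<Sum>i<N. \<bar>f i x\<bar>) \<partial>M)"
    using int by (intro Bochner_Integration.integral_sum[symmetric]) auto
  also have "\<dots> \<le> (\<integral>x. w x \<partial>M)"
    using int w by (intro integral_mono le) auto
  finally show "(\<Sum>i<N. \<bar>\<integral>x. f i x \<partial>M\<bar>) \<le> (\<integral>x. w x \<partial>M)" .
qed

text \<open>This is the previous lemma for counting measure on the naturals: \<open>k\<close> is the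
  point, and the sum over \<open>k\<close> is the integral.\<close>

lemma
  fixes a :: "nat \<Rightarrow> nat \<Rightarrow> real"
  assumes w: "summable w" and le: "\<And>N k. (\<Sum>n<N. \<bar>a n k\<bar>) \<le> w k"
  shows summable_dominated_series: "summable (a n)"
    and sums_suminf_dominated: "(\<lambda>n. \<Sum>k. a n k) sums (\<Sum>k. \<Sum>n. a n k)"
proof -
  have w0: "w k \<ge> 0" for k using le[where N=0] by simp
  have iw: "integrable (count_space UNIV) w"
    using w w0 by (simp add: integrable_count_space_nat_iff)
  have int: "integrable (count_space UNIV) (a n)" for n
    by (rule integrable_dominated_series[OF _ iw]) (use le in auto)
  show "summable (a n)" for n
    using int[of n] by (simp add: integrable_count_space_nat_iff summable_rabs_cancel)
  have S: "(\<lambda>n. \<integral>k. a n k \<partial>count_space UNIV) sums (\<integral>k. (\<Sum>n. a n k) \<partial>count_space UNIV)"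
    by (rule sums_integral_dominated[OF _ iw]) (use le in auto)
  \<comment> \<open>\<open>integral_count_space_nat\<close> rewrites an integral as
    \<open>suminf\<close> only for integrable functions, so the inner sums must be dominated by
    \<open>w\<close> as well.\<close>
  have "integrable (count_space UNIV) (\<lambda>k. \<Sum>n. a n k)"
  proof (rule Bochner_Integration.integrable_bound[OF iw])
    have "\<bar>\<Sum>n. a n k\<bar> \<le> w k" for k
    proof -
      have s: "summable (\<lambda>n. \<bar>a n k\<bar>)"
        by (rule bounded_imp_summable[of _ "w k"]) (use le in \<open>auto simp del: sum.lessThan_Suc simp flip: lessThan_Suc_atMost\<close>)
      show ?thesis
        using summable_rabs[OF s] suminf_le_const[OF s le] by linarith
    qed
    thus "AE k in count_space UNIV. norm (\<Sum>n. a n k) \<le> norm (w k)"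
      using w0 by simp
  qed simp
  thus "(\<lambda>n. \<Sum>k. a n k) sums (\<Sum>k. \<Sum>n. a n k)"
    using S int by (simp add: integral_count_space_nat)
qed

section \<open>Exponential moments of the absolute value near the origin\<close>

lemma integrable_exp_abs:
  assumes "Y \<in> borel_measurable M"
    and "\<And>s. \<bar>s\<bar> < \<delta> \<Longrightarrow> integrable M (\<lambda>\<omega>. exp (s * Y \<omega>))" and "\<bar>c\<bar> < \<delta>"
  shows "integrable M (\<lambda>\<omega>. exp (c * \<bar>Y \<omega>\<bar>) :: real)"
proof (rule Bochner_Integration.integrable_bound)
  \<comment> \<open>\<open>exp (c * \<bar>y\<bar>)\<close> is one of these two summands and the
    other is positive; both signs of the argument of the moment generating function are
    used.\<close>
  show "integrable M (\<lambda>\<omega>. exp (c * Y \<omega>) + exp (- c * Y \<omega>))"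
    by (intro Bochner_Integration.integrable_add assms(2)) (use assms(3) in auto)
  show "AE \<omega> in M. norm (exp (c * \<bar>Y \<omega>\<bar>)) \<le> norm (exp (c * Y \<omega>) + exp (- c * Y \<omega>))"
    by (intro AE_I2) (simp add: abs_real_def[of "Y _"])
qed (use assms(1) in measurable)

lemma eventually_integrable_deg_exp_abs:
  assumes "lam \<noteq> 0" "Y \<in> borel_measurable M" "mgf_exists_near_0 M Y"
  shows "\<forall>\<^sub>F t in nhds 0. \<bar>lam * t\<bar> < 1 \<and> integrable M (\<lambda>\<omega>. deg_exp (- \<bar>lam\<bar>) \<bar>Y \<omega>\<bar> \<bar>t\<bar>)"
proof -
  obtain \<delta> where \<delta>: "\<delta> > 0" "\<And>s. \<bar>s\<bar> < \<delta> \<Longrightarrow> integrable M (\<lambda>\<omega>. exp (s * Y \<omega>))"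
    using assms(3) unfolding mgf_exists_near_0_def by blast
  \<comment> \<open>The majorant at \<open>y\<close> equals
    \<open>exp (?c t * \<bar>y\<bar>)\<close>. Since \<open>?c\<close> is continuous at 0 with value
    0, the rate eventually falls below \<open>\<delta>\<close>.\<close>
  let ?c = "\<lambda>t. ln (1 + - \<bar>lam\<bar> * \<bar>t\<bar>) / - \<bar>lam\<bar>"
  have "((\<lambda>t. \<bar>lam * t\<bar>) \<longlongrightarrow> \<bar>lam * 0\<bar>) (nhds 0)"
    by (intro tendsto_intros filterlim_ident)
  hence 1: "\<forall>\<^sub>F t in nhds 0. \<bar>lam * t\<bar> < 1"
    by (rule order_tendstoD) simp
  have "((\<lambda>t. \<bar>?c t\<bar>) \<longlongrightarrow> \<bar>?c 0\<bar>) (nhds 0)"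
    using assms(1) by (intro tendsto_intros filterlim_ident) auto
  hence "\<forall>\<^sub>F t in nhds 0. \<bar>?c t\<bar> < \<delta>"
    by (rule order_tendstoD) (use \<delta>(1) in simp)
  with 1 show ?thesis
  proof eventually_elim
    case (elim t)
    have "integrable M (\<lambda>\<omega>. exp (?c t * \<bar>Y \<omega>\<bar>))"
      by (rule integrable_exp_abs[OF assms(2) \<delta>(2) elim(2)])
    moreover have "deg_exp (- \<bar>lam\<bar>) \<bar>y\<bar> \<bar>t\<bar> = exp (?c t * \<bar>y\<bar>)" for y
      using elim(1) by (subst deg_exp_eq_exp) (auto simp: abs_mult mult.commute)
    ultimately show ?case using elim(1) by simp
  qed
qed

section \<open>Expectations of functions of the partial sums\<close>

context prob_space
begin

text \<open>A general Borel function \<open>g\<close> is allowed because two instances are wanted: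
  the degenerate exponential itself and its majorant.\<close>

lemma
  fixes g :: "real \<Rightarrow> real"
  assumes iid: "iid_copies M Y Ys" and Y: "Y \<in> borel_measurable M"
    and g [measurable]: "g \<in> borel_measurable borel" and int: "integrable M (\<lambda>\<omega>. g (Y \<omega>))"
  shows iid_copies_integrable_prod: "integrable M (\<lambda>\<omega>. \<Prod>j=1..m. g (Ys j \<omega>))"
    and iid_copies_integral_prod: "(\<integral>\<omega>. (\<Prod>j=1..m. g (Ys j \<omega>)) \<partial>M) = (\<integral>\<omega>. g (Y \<omega>) \<partial>M) ^ m"
proof -
  have ind: "indep_vars (\<lambda>_. borel) Ys {1..}" and distr: "\<And>j. j \<ge> 1 \<Longrightarrow> distr M borel (Ys j) = distr M borel Y"
    using iid by (auto simp: iid_copies_def)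
  have Ys [measurable]: "Ys j \<in> borel_measurable M" if "j \<ge> 1" for j
    using ind that by (auto simp: indep_vars_def)
  have "indep_vars (\<lambda>_. borel) Ys {1..m}"
    by (rule indep_vars_subset[OF ind]) auto
  hence ind': "indep_vars (\<lambda>_. borel) (\<lambda>j \<omega>. g (Ys j \<omega>)) {1..m}"
    by (rule indep_vars_compose2) simp
  have int': "integrable M (\<lambda>\<omega>. g (Ys j \<omega>))" if "j \<in> {1..m}" for j
    using integrable_distr_eq[OF Ys g, of j] integrable_distr_eq[OF Y g] distr[of j] int that by auto
  have eq: "(\<integral>\<omega>. g (Ys j \<omega>) \<partial>M) = (\<integral>\<omega>. g (Y \<omega>) \<partial>M)" if "j \<in> {1..m}" for j
    using integral_distr[OF Ys g, of j] integral_distr[OF Y g] distr[of j] that by auto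
  show "integrable M (\<lambda>\<omega>. \<Prod>j=1..m. g (Ys j \<omega>))"
    by (rule indep_vars_integrable) (use ind' int' in auto)
  have "(\<integral>\<omega>. (\<Prod>j=1..m. g (Ys j \<omega>)) \<partial>M) = (\<Prod>j=1..m. \<integral>\<omega>. g (Ys j \<omega>) \<partial>M)"
    by (rule indep_vars_lebesgue_integral) (use ind' int' in auto)
  thus "(\<integral>\<omega>. (\<Prod>j=1..m. g (Ys j \<omega>)) \<partial>M) = (\<integral>\<omega>. g (Y \<omega>) \<partial>M) ^ m"
    using eq by simp
qed

lemma
  assumes lam: "lam \<noteq> 0" and Y [measurable]: "Y \<in> borel_measurable M" and iid: "iid_copies M Y Ys"
    and t: "\<bar>lam * t\<bar> < 1" and int: "integrable M (\<lambda>\<omega>. deg_exp (- \<bar>lam\<bar>) \<bar>Y \<omega>\<bar> \<bar>t\<bar>)"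
  shows expectation_deg_exp_partial_sum:
      "(\<integral>\<omega>. deg_exp lam (partial_sum Ys m \<omega>) t \<partial>M) = (\<integral>\<omega>. deg_exp lam (Y \<omega>) t \<partial>M) ^ m"
    and expectation_deg_falling_sums:
      "(\<lambda>n. (\<integral>\<omega>. deg_falling lam (partial_sum Ys m \<omega>) n \<partial>M) * (t ^ n / fact n)) sums
        (\<integral>\<omega>. deg_exp lam (Y \<omega>) t \<partial>M) ^ m"
    and sum_abs_expectation_deg_falling_le:
      "(\<Sum>n<N. \<bar>(\<integral>\<omega>. deg_falling lam (partial_sum Ys m \<omega>) n \<partial>M) * (t ^ n / fact n)\<bar>)
        \<le> (\<integral>\<omega>. deg_exp (- \<bar>lam\<bar>) \<bar>Y \<omega>\<bar> \<bar>t\<bar> \<partial>M) ^ m"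
proof -
  let ?h = "\<lambda>y. deg_exp (- \<bar>lam\<bar>) \<bar>y\<bar> \<bar>t\<bar>"
  let ?S = "partial_sum Ys m"
  have Ys [measurable]: "Ys j \<in> borel_measurable M" if "j \<ge> 1" for j
    using iid that by (auto simp: iid_copies_def indep_vars_def)
  have S [measurable]: "?S \<in> borel_measurable M"
    unfolding partial_sum_def using Ys by (intro borel_measurable_sum) auto
  have pos: "1 + lam * t > 0" using t by linarith
  have pos': "1 + - \<bar>lam\<bar> * \<bar>t\<bar> > 0" using t by (simp add: abs_mult)
  \<comment> \<open>Letting \<open>N\<close> tend to infinity in the bound on partial sums makes
    integrability of the majorant pass to \<open>deg_exp lam (Y \<omega>) t\<close>.\<close>
  have "\<bar>deg_exp lam y t\<bar> \<le> ?h y" for y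
  proof (rule LIMSEQ_le_const2)
    show "(\<lambda>N. \<bar>\<Sum>n<N. deg_falling lam y n * (t ^ n / fact n)\<bar>) \<longlonglongrightarrow> \<bar>deg_exp lam y t\<bar>"
      using deg_exp_sums[OF lam t, of y] by (intro tendsto_rabs) (simp add: sums_def)
    show "\<exists>N0. \<forall>N\<ge>N0. \<bar>\<Sum>n<N. deg_falling lam y n * (t ^ n / fact n)\<bar> \<le> ?h y"
      using order_trans[OF sum_abs sum_abs_deg_falling_le[OF lam t]] by blast
  qed
  hence "integrable M (\<lambda>\<omega>. deg_exp lam (Y \<omega>) t)"
    by (intro Bochner_Integration.integrable_bound[OF int] AE_I2)
      (auto intro: order_trans[OF _ abs_ge_self])
  thus eq: "(\<integral>\<omega>. deg_exp lam (?S \<omega>) t \<partial>M) = (\<integral>\<omega>. deg_exp lam (Y \<omega>) t \<partial>M) ^ m"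
    unfolding partial_sum_def deg_exp_sum[OF pos]
    by (intro iid_copies_integral_prod[OF iid Y]) auto
  \<comment> \<open>The dominating function is this product rather than
    \<open>?h (?S \<omega>)\<close>: independence makes its expectation exactly an
    \<open>m\<close>-th power.\<close>
  have w: "integrable M (\<lambda>\<omega>. \<Prod>j=1..m. ?h (Ys j \<omega>))"
    and w_eq: "(\<integral>\<omega>. (\<Prod>j=1..m. ?h (Ys j \<omega>)) \<partial>M) = (\<integral>\<omega>. ?h (Y \<omega>) \<partial>M) ^ m"
    using int by (intro iid_copies_integrable_prod[OF iid Y] iid_copies_integral_prod[OF iid Y]; measurable)+
  have le: "(\<Sum>n<N. \<bar>deg_falling lam (?S \<omega>) n * (t ^ n / fact n)\<bar>) \<le> (\<Prod>j=1..m. ?h (Ys j \<omega>))" for N \<omega>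
  proof -
    have "?h (?S \<omega>) \<le> deg_exp (- \<bar>lam\<bar>) (\<Sum>j=1..m. \<bar>Ys j \<omega>\<bar>) \<bar>t\<bar>"
      unfolding partial_sum_def by (rule deg_exp_abs_mono[OF t sum_abs])
    thus ?thesis
      using sum_abs_deg_falling_le[OF lam t, of "?S \<omega>" N] by (simp add: deg_exp_sum[OF pos'])
  qed
  have "(\<Sum>n. deg_falling lam y n * (t ^ n / fact n)) = deg_exp lam y t" for y
    using deg_exp_sums[OF lam t] by (rule sums_unique[symmetric])
  thus "(\<lambda>n. (\<integral>\<omega>. deg_falling lam (?S \<omega>) n \<partial>M) * (t ^ n / fact n)) sums
      (\<integral>\<omega>. deg_exp lam (Y \<omega>) t \<partial>M) ^ m"
    using sums_integral_dominated[OF _ w le] eq by simp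
  show "(\<Sum>n<N. \<bar>(\<integral>\<omega>. deg_falling lam (?S \<omega>) n \<partial>M) * (t ^ n / fact n)\<bar>)
      \<le> (\<integral>\<omega>. ?h (Y \<omega>) \<partial>M) ^ m"
    using sum_abs_integral_dominated_le[OF _ w le, of N] w_eq by simp
qed

section \<open>The series over \<open>k\<close> and its exponential generating function\<close>

lemma
  fixes x :: real and r :: nat
  assumes lam: "lam \<noteq> 0" and Y: "Y \<in> borel_measurable M" and iid: "iid_copies M Y Ys"
    and t: "\<bar>lam * t\<bar> < 1" and int: "integrable M (\<lambda>\<omega>. deg_exp (- \<bar>lam\<bar>) \<bar>Y \<omega>\<bar> \<bar>t\<bar>)"
  defines "c \<equiv> \<lambda>n k. x ^ k * ((\<integral>\<omega>. deg_falling lam (partial_sum Ys (k + r) \<omega>) n \<partial>M) / fact k)"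
  shows summable_dobinski: "t \<noteq> 0 \<Longrightarrow> summable (c n)"
    and dobinski_sums: "(\<lambda>n. (exp (- x) * (\<Sum>k. c n k)) * (t ^ n / fact n)) sums
      ((\<integral>\<omega>. deg_exp lam (partial_sum Ys r \<omega>) t \<partial>M) *
        exp (x * ((\<integral>\<omega>. deg_exp lam (Y \<omega>) t \<partial>M) - 1)))"
proof -
  define A where "A = (\<integral>\<omega>. deg_exp (- \<bar>lam\<bar>) \<bar>Y \<omega>\<bar> \<bar>t\<bar> \<partial>M)"
  define \<phi> where "\<phi> = (\<integral>\<omega>. deg_exp lam (Y \<omega>) t \<partial>M)"
  define e where "e = (\<lambda>m n. (\<integral>\<omega>. deg_falling lam (partial_sum Ys m \<omega>) n \<partial>M) * (t ^ n / fact n))"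
  define a where "a = (\<lambda>n k. c n k * (t ^ n / fact n))"
  have a: "a n k = x ^ k / fact k * e (k + r) n" for n k
    by (simp add: a_def c_def e_def)
  \<comment> \<open>This is \<open>A ^ r\<close> times the exponential series at
    \<open>\<bar>x\<bar> * A\<close>; the factorial absorbs the geometric growth of the
    moments.\<close>
  have w: "summable (\<lambda>k. \<bar>x\<bar> ^ k / fact k * A ^ (k + r))"
    using summable_mult[OF summable_exp[of "\<bar>x\<bar> * A"], of "A ^ r"]
    by (simp add: power_add power_mult_distrib field_simps)
  have le: "(\<Sum>n<N. \<bar>a n k\<bar>) \<le> \<bar>x\<bar> ^ k / fact k * A ^ (k + r)" for N k
  proof -
    have "(\<Sum>n<N. \<bar>a n k\<bar>) = \<bar>x\<bar> ^ k / fact k * (\<Sum>n<N. \<bar>e (k + r) n\<bar>)"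
      by (simp add: a abs_mult power_abs sum_distrib_left)
    also have "\<dots> \<le> \<bar>x\<bar> ^ k / fact k * A ^ (k + r)"
      unfolding e_def A_def
      by (intro mult_left_mono sum_abs_expectation_deg_falling_le[OF lam Y iid t int]) auto
    finally show ?thesis .
  qed
  have summ: "summable (a n)" for n
    by (rule summable_dominated_series[OF w le])
  \<comment> \<open>Domination concerns the terms weighted by \<open>t ^ n\<close>, so the weight
    has to be divided out. The condition on \<open>t ^ n\<close> also admits \<open>t = 0\<close>
    with \<open>n = 0\<close>.\<close>
  have summ_c: "summable (c n)" if "t ^ n \<noteq> 0" for n
    using summable_mult2[OF summ[of n], of "fact n / t ^ n"] that by (cases "t = 0") (auto simp: a_def)
  thus "t \<noteq> 0 \<Longrightarrow> summable (c n)"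
    by simp
  have col: "(\<Sum>n. a n k) = \<phi> ^ r * ((x * \<phi>) ^ k / fact k)" for k
    using sums_mult[OF expectation_deg_falling_sums[OF lam Y iid t int, of "k + r"], of "x ^ k / fact k"]
    by (auto simp: a e_def \<phi>_def power_add power_mult_distrib field_simps dest!: sums_unique[symmetric])
  have "(\<lambda>k. \<phi> ^ r * ((x * \<phi>) ^ k / fact k)) sums (\<phi> ^ r * exp (x * \<phi>))"
    using exp_converges[of "x * \<phi>"] by (intro sums_mult) (simp add: field_simps)
  hence "(\<Sum>k. \<Sum>n. a n k) = \<phi> ^ r * exp (x * \<phi>)"
    unfolding col by (rule sums_unique[symmetric])
  with sums_suminf_dominated[OF w le] have "(\<lambda>n. \<Sum>k. a n k) sums (\<phi> ^ r * exp (x * \<phi>))"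
    by simp
  from sums_mult[OF this, of "exp (- x)"]
  have "(\<lambda>n. exp (- x) * (\<Sum>k. a n k)) sums (\<phi> ^ r * exp (x * (\<phi> - 1)))"
    by (simp add: right_diff_distrib exp_diff exp_minus field_simps)
  moreover have "(\<Sum>k. a n k) = (\<Sum>k. c n k) * (t ^ n / fact n)" for n
  \<comment> \<open>In the exceptional case \<open>t ^ n = 0\<close>, so both sides vanish whatever
    value \<open>suminf\<close> assigns to \<open>c n\<close>.\<close>
  proof (cases "t = 0 \<and> n > 0")
    case False
    hence "summable (c n)"
      by (intro summ_c) auto
    thus ?thesis unfolding a_def by (rule suminf_mult2[symmetric])
  qed (auto simp: a_def power_0_left)
  ultimately show "(\<lambda>n. (exp (- x) * (\<Sum>k. c n k)) * (t ^ n / fact n)) sums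
      ((\<integral>\<omega>. deg_exp lam (partial_sum Ys r \<omega>) t \<partial>M) * exp (x * ((\<integral>\<omega>. deg_exp lam (Y \<omega>) t \<partial>M) - 1)))"
    by (simp add: expectation_deg_exp_partial_sum[OF lam Y iid t int] \<phi>_def mult.assoc)
qed

end

theorem theorem2p7:
  fixes M :: "'a measure" and lam x :: real and Y :: "'a \<Rightarrow> real"
    and Ys :: "nat \<Rightarrow> 'a \<Rightarrow> real" and n r :: nat
  assumes "prob_space M"
    and "lam \<noteq> 0"
    and "Y \<in> borel_measurable M"
    and "mgf_exists_near_0 M Y"
    and "iid_copies M Y Ys"
  shows "summable (\<lambda>k. x ^ k * ((\<integral>\<omega>. deg_falling lam (partial_sum Ys (k + r) \<omega>) n \<partial>M) / fact k))
    \<and> prob_deg_r_bell M lam Y Ys r n x =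
        exp (- x) * (\<Sum>k. x ^ k * ((\<integral>\<omega>. deg_falling lam (partial_sum Ys (k + r) \<omega>) n \<partial>M) / fact k))"
proof
  interpret prob_space M by fact
  note ev = eventually_integrable_deg_exp_abs[OF assms(2-4)]
  \<comment> \<open>Summability of the coefficients does not involve \<open>t\<close>, so a single
    nonzero admissible \<open>t\<close> suffices; the punctured neighbourhood provides one.\<close>
  have "\<forall>\<^sub>F t in at 0. t \<noteq> 0 \<and> \<bar>lam * t\<bar> < 1 \<and> integrable M (\<lambda>\<omega>. deg_exp (- \<bar>lam\<bar>) \<bar>Y \<omega>\<bar> \<bar>t\<bar>)"
    unfolding eventually_at_filter using ev by eventually_elim simp
  then obtain t :: real where "t \<noteq> 0" "\<bar>lam * t\<bar> < 1" "integrable M (\<lambda>\<omega>. deg_exp (- \<bar>lam\<bar>) \<bar>Y \<omega>\<bar> \<bar>t\<bar>)"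
    using eventually_happens'[OF at_neq_bot] by blast
  thus "summable (\<lambda>k. x ^ k * ((\<integral>\<omega>. deg_falling lam (partial_sum Ys (k + r) \<omega>) n \<partial>M) / fact k))"
    by (intro summable_dobinski[OF assms(2,3,5)])
  let ?G = "\<lambda>t. (\<integral>\<omega>. deg_exp lam (partial_sum Ys r \<omega>) t \<partial>M) *
    exp (x * ((\<integral>\<omega>. deg_exp lam (Y \<omega>) t \<partial>M) - 1))"
  let ?b = "\<lambda>n. exp (- x) *
    (\<Sum>k. x ^ k * ((\<integral>\<omega>. deg_falling lam (partial_sum Ys (k + r) \<omega>) n \<partial>M) / fact k))"
  have egf: "is_egf_of ?G ?b"
    unfolding is_egf_of_def using ev
    by eventually_elim (intro dobinski_sums[OF assms(2,3,5)], auto)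
  \<comment> \<open>Existence comes from \<open>egf\<close> and uniqueness from the identity theorem
    for power series, so the description operator returns \<open>?b\<close>.\<close>
  have "(THE b. is_egf_of ?G b) = ?b"
    by (rule the_equality[of "is_egf_of ?G" ?b, OF egf]) (erule is_egf_of_unique[OF _ egf])
  thus "prob_deg_r_bell M lam Y Ys r n x = ?b n"
    unfolding prob_deg_r_bell_def by simp
qed

end
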